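(* Let $\mathbf X\in\mathbb R^d$ be elliptical with positive definite covariance $\boldsymbol\Sigma=\mathbf V\boldsymbol\Lambda\mathbf V'$, $\mathbf Y=\mathbf V'\mathbf X$, and $\alpha\in(0,1)$. Let $\mathcal P$ be the set of $d\times d$ orthogonal matrices; for $\mathbf P\in\mathcal P$ put $\tilde{\mathbf Y}=\mathbf P\mathbf X=(\tilde Y_1,\dots,\tilde Y_d)$. Then for each $i\in\{1,\dots,d\}$, $$\max_{\mathbf P\in\mathcal P}\mathrm{Tr}\,\mathrm{Cov}\big(\tilde{\mathbf Y}\mid\tilde Y_i\in\mathsf T^\alpha_{\tilde Y_i}\big)=\mathrm{Tr}\,\mathrm{Cov}\big(\mathbf Y\mid Y_d\in\mathsf T^\alpha_{Y_d}\big),$$ $$\min_{\mathbf P\in\mathcal P}\mathrm{Tr}\,\mathrm{Cov}\big(\tilde{\mathbf Y}\mid\tilde Y_i\in\mathsf T^\alpha_{\tilde Y_i}\big)=\mathrm{Tr}\,\mathrm{Cov}\big(\mathbf Y\mid Y_1\in\mathsf T^\alpha_{Y_1}\big).$$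
   Context: A random vector $\mathbf X\in\mathbb R^d$ belongs to the elliptical family with parameters $(\boldsymbol\mu,\boldsymbol\Sigma,\phi)$ if its characteristic function is $\mathbb E[e^{i\mathbf t'\mathbf X}]=e^{i\mathbf t'\boldsymbol\mu}\phi(\mathbf t'\boldsymbol\Sigma\mathbf t)$ for all $\mathbf t\in\mathbb R^d$, for some scalar function $\phi$; here $\mathbf X$ is assumed to have finite second moments and covariance matrix $\boldsymbol\Sigma$, positive definite, and the conditioning events have positive probability. Spectral decomposition: $\boldsymbol\Sigma=\mathbf V\boldsymbol\Lambda\mathbf V'$ with $\mathbf V$ orthogonal (orthonormal eigenvectors as columns) and $\boldsymbol\Lambda=\mathrm{diag}(\lambda_1,\dots,\lambda_d)$, $\lambda_1\ge\cdots\ge\lambda_d>0$. For a real random variable $W$, $Q_W(p)=\inf\{x:\mathbb P(W\le x)\ge p\}$ and $\mathsf T^\alpha_W:=[Q_W(\alpha/2),Q_W(1-\alpha/2)]$. *)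

theory Defs
  imports "HOL-Probability.Probability"
begin

definition quantile :: "'a measure \<Rightarrow> ('a \<Rightarrow> real) \<Rightarrow> real \<Rightarrow> real" where
  "quantile M W p = Inf {x. measure M {\<omega> \<in> space M. W \<omega> \<le> x} \<ge> p}"

definition tint :: "'a measure \<Rightarrow> ('a \<Rightarrow> real) \<Rightarrow> real \<Rightarrow> real set" where
  "tint M W \<alpha> = {quantile M W (\<alpha> / 2) .. quantile M W (1 - \<alpha> / 2)}"

definition cexp :: "'a measure \<Rightarrow> 'a set \<Rightarrow> ('a \<Rightarrow> real) \<Rightarrow> real" where
  "cexp M A f = (\<integral>\<omega>. indicator A \<omega> * f \<omega> \<partial>M) / measure M A"

definition ccov :: "'a measure \<Rightarrow> 'a set \<Rightarrow> ('a \<Rightarrow> real^'d) \<Rightarrow> real^'d^'d" where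
  "ccov M A Z = (\<chi> i j. cexp M A (\<lambda>\<omega>. (Z \<omega> $ i - cexp M A (\<lambda>\<omega>'. Z \<omega>' $ i))
                                      * (Z \<omega> $ j - cexp M A (\<lambda>\<omega>'. Z \<omega>' $ j))))"

definition cov :: "'a measure \<Rightarrow> ('a \<Rightarrow> real^'d) \<Rightarrow> real^'d^'d" where
  "cov M Z = (\<chi> i j. integral\<^sup>L M (\<lambda>\<omega>. (Z \<omega> $ i - integral\<^sup>L M (\<lambda>\<omega>'. Z \<omega>' $ i))
                                      * (Z \<omega> $ j - integral\<^sup>L M (\<lambda>\<omega>'. Z \<omega>' $ j))))"

definition tevent :: "'a measure \<Rightarrow> ('a \<Rightarrow> real^'d) \<Rightarrow> 'd \<Rightarrow> real \<Rightarrow> 'a set" where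
  "tevent M Z i \<alpha> = {\<omega> \<in> space M. Z \<omega> $ i \<in> tint M (\<lambda>\<omega>'. Z \<omega>' $ i) \<alpha>}"

definition elliptical ::
  "'a measure \<Rightarrow> ('a \<Rightarrow> real^'d) \<Rightarrow> real^'d \<Rightarrow> real^'d^'d \<Rightarrow> (real \<Rightarrow> complex) \<Rightarrow> bool" where
  "elliptical M X \<mu> \<Sigma> \<phi> \<longleftrightarrow>
     (\<forall>t. (\<integral>\<omega>. cis (t \<bullet> X \<omega>) \<partial>M) = cis (t \<bullet> \<mu>) * \<phi> (t \<bullet> (\<Sigma> *v t)))"

end

theory Submission
  imports Defs
begin

text \<open>
  A characteristic function on the plane determines the law, so the joint law of two centred
  projections \<open>u \<bullet> (X - \<mu>)\<close>, \<open>w \<bullet> (X - \<mu>)\<close> depends only on the Gram matrix of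
  \<open>u\<close>, \<open>w\<close> for the form \<open>\<Sigma>\<close>. Let \<open>p\<close> be the conditioning direction and split every
  row of \<open>P\<close> into its \<open>\<Sigma>\<close>-component along \<open>p\<close> and a \<open>\<Sigma>\<close>-orthogonal rest. This gives
  \<open>Tr Cov = c Tr \<Sigma> - (c - k) |\<Sigma> p|\<^sup>2 / (p \<bullet> \<Sigma> p)\<close>, where \<open>k\<close> and \<open>c\<close> are the trimmed
  variances of a standardised projection in the conditioning direction and in an orthogonal one,
  independent of \<open>P\<close>. The quotient lies between the extreme eigenvalues and equals the
  eigenvalue at an eigenvector, so only \<open>k \<le> c\<close> is left. For an exchangeable pair \<open>(N, N')\<close>,
  the event \<open>|N| \<le> h\<close> and its mirror image \<open>|N'| \<le> h\<close> differ by outcomes with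
  \<open>N\<^sup>2 < N'\<^sup>2\<close> in the former and \<open>N\<^sup>2 > N'\<^sup>2\<close> in the latter.
\<close>

section \<open>Laws determined by characteristic functions\<close>

text \<open>Scaled to total mass one, the weights \<open>h\<close> and \<open>k\<close> become
  densities of probability measures under which \<open>f\<close> and \<open>g\<close> have the same
  characteristic function, so Levy's uniqueness theorem applies. Weights of mass zero vanish almost
  everywhere and are treated apart.\<close>

lemma weighted_law_eqI:
  fixes f h :: "'a \<Rightarrow> real" and g k :: "'b \<Rightarrow> real"
  assumes [measurable]: "f \<in> borel_measurable M" "g \<in> borel_measurable N"
    and h: "integrable M h" "\<And>x. 0 \<le> h x" and k: "integrable N k" "\<And>x. 0 \<le> k x"
    and eq: "\<And>s. (\<integral>x. h x *\<^sub>R cis (s * f x) \<partial>M) = (\<integral>x. k x *\<^sub>R cis (s * g x) \<partial>N)"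
    and A[measurable]: "A \<in> sets borel"
  shows "(\<integral>x. h x * indicator A (f x) \<partial>M) = (\<integral>x. k x * indicator A (g x) \<partial>N)"
proof -
  define m where "m = (\<integral>x. h x \<partial>M)"
  have [measurable]: "h \<in> borel_measurable M" "k \<in> borel_measurable N"
    using h k by auto
  \<comment> \<open>At frequency zero the hypothesis compares the total masses, so one constant
    \<open>m\<close> normalises both sides.\<close>
  have "complex_of_real (\<integral>x. h x \<partial>M) = complex_of_real (\<integral>x. k x \<partial>N)"
    using eq[of 0] by (simp add: scaleR_conv_of_real)
  then have mk: "m = (\<integral>x. k x \<partial>N)" by (simp add: m_def)
  have m0: "m \<ge> 0" by (simp add: m_def h)
  show ?thesis
  proof (cases "m = 0")
    case True
    have "AE x in M. h x = 0" "AE x in N. k x = 0"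
      using True mk h k by (simp_all add: m_def integral_nonneg_eq_0_iff_AE[symmetric])
    then have "(\<integral>x. h x * indicator A (f x) \<partial>M) = (\<integral>x. 0 \<partial>M)"
      "(\<integral>x. k x * indicator A (g x) \<partial>N) = (\<integral>x. 0 \<partial>N)"
      by (intro integral_cong_AE; auto)+
    then show ?thesis by simp
  next
    case False
    with m0 have m: "m > 0" by simp
    define P where "P = density M (\<lambda>x. h x / m)"
    define Q where "Q = density N (\<lambda>x. k x / m)"
    have [measurable_cong]: "sets P = sets M" "sets Q = sets N" by (auto simp: P_def Q_def)
    have "prob_space P"
    proof
      have "emeasure P (space P) = (\<integral>\<^sup>+x. ennreal (h x / m) \<partial>M)"
        by (simp add: P_def emeasure_density cong: nn_integral_cong)
      also have "\<dots> = ennreal (\<integral>x. h x / m \<partial>M)"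
        using h m by (intro nn_integral_eq_integral) auto
      also have "\<dots> = 1" using m by (simp add: m_def[symmetric])
      finally show "emeasure P (space P) = 1" .
    qed
    moreover have "prob_space Q"
    proof
      have "emeasure Q (space Q) = (\<integral>\<^sup>+x. ennreal (k x / m) \<partial>N)"
        by (simp add: Q_def emeasure_density cong: nn_integral_cong)
      also have "\<dots> = ennreal (\<integral>x. k x / m \<partial>N)"
        using k m by (intro nn_integral_eq_integral) auto
      also have "\<dots> = 1" using m by (simp add: mk[symmetric])
      finally show "emeasure Q (space Q) = 1" .
    qed
    ultimately have rd: "real_distribution (distr P borel f)" "real_distribution (distr Q borel g)"
      by (auto intro!: prob_space.real_distribution_distr)
    have P: "(\<integral>x. F x \<partial>P) = (\<integral>x. h x *\<^sub>R F x \<partial>M) /\<^sub>R m"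
      if [measurable]: "F \<in> borel_measurable M" for F :: "'a \<Rightarrow> 'c::{banach, second_countable_topology}"
    proof -
      have "(\<integral>x. F x \<partial>P) = (\<integral>x. (1/m) *\<^sub>R (h x *\<^sub>R F x) \<partial>M)"
        unfolding P_def using h m by (subst integral_density) auto
      then show ?thesis by (simp only: integral_scaleR_right inverse_eq_divide)
    qed
    have Q: "(\<integral>x. F x \<partial>Q) = (\<integral>x. k x *\<^sub>R F x \<partial>N) /\<^sub>R m"
      if [measurable]: "F \<in> borel_measurable N" for F :: "'b \<Rightarrow> 'c::{banach, second_countable_topology}"
    proof -
      have "(\<integral>x. F x \<partial>Q) = (\<integral>x. (1/m) *\<^sub>R (k x *\<^sub>R F x) \<partial>N)"
        unfolding Q_def using k m by (subst integral_density) auto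
      then show ?thesis by (simp only: integral_scaleR_right inverse_eq_divide)
    qed
    have "char (distr P borel f) = char (distr Q borel g)"
    proof
      fix s
      have "char (distr P borel f) s = (\<integral>x. cis (s * f x) \<partial>P)"
        by (simp add: char_def integral_distr cis_conv_exp)
      also have "\<dots> = (\<integral>x. cis (s * g x) \<partial>Q)"
        using eq[of s] by (simp add: P Q cis_conv_exp)
      also have "\<dots> = char (distr Q borel g) s"
        by (simp add: char_def integral_distr cis_conv_exp)
      finally show "char (distr P borel f) s = char (distr Q borel g) s" .
    qed
    then have "distr P borel f = distr Q borel g"
      using rd by (intro Levy_uniqueness)
    then have "(\<integral>y. indicator A y \<partial>distr P borel f) = ((\<integral>y. indicator A y \<partial>distr Q borel g) :: real)"
      by simp
    then have "(\<integral>x. indicator A (f x) \<partial>P) = ((\<integral>x. indicator A (g x) \<partial>Q) :: real)"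
      by (subst (asm) (1 2) integral_distr) auto
    then show ?thesis using m by (simp add: P Q)
  qed
qed

lemma borel_measurable_cis [measurable]: "cis \<in> borel_measurable borel"
  by (intro borel_measurable_continuous_onI continuous_intros)

text \<open>Euler's formula turns the weight into frequency shifts by \<open>b\<close> and
  \<open>-b\<close>; the summand 1 keeps the weight nonnegative.\<close>

lemma one_plus_cos_scaleR_cis:
  "(1 + cos b) *\<^sub>R cis a = cis a + (1/2) *\<^sub>R (cis (a + b) + cis (a - b))"
  by (auto simp: complex_eq_iff cos_add cos_diff sin_add sin_diff algebra_simps)

lemma one_plus_sin_scaleR_cis:
  "(1 + sin b) *\<^sub>R cis a = cis a + (1/2) *\<^sub>R (\<i> * cis (a - b) - \<i> * cis (a + b))"
  by (auto simp: complex_eq_iff cos_add cos_diff sin_add sin_diff algebra_simps)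

lemma one_plus_cos_sin_bounds:
  fixes b :: real
  shows "\<bar>1 + cos b\<bar> \<le> 2" "\<bar>1 + sin b\<bar> \<le> 2" "0 \<le> 1 + cos b" "0 \<le> 1 + sin b"
  using cos_le_one[of b] cos_ge_minus_one[of b] sin_le_one[of b] sin_ge_minus_one[of b] by linarith+

context prob_space
begin

lemma integrable_cis:
  assumes [measurable]: "X \<in> borel_measurable M"
  shows "integrable M (\<lambda>x. cis (X x))"
  by (intro integrable_const_bound[of _ 1]) auto

context
  fixes X Y :: "'a \<Rightarrow> real"
  assumes XY[measurable]: "X \<in> borel_measurable M" "Y \<in> borel_measurable M"
begin

lemma integral_cos_weighted_cis:
  "(\<integral>x. (1 + cos (t * Y x)) *\<^sub>R cis (s * X x) \<partial>M) = (\<integral>x. cis (s * X x) \<partial>M)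
    + (1/2) *\<^sub>R ((\<integral>x. cis (s * X x + t * Y x) \<partial>M) + (\<integral>x. cis (s * X x + (- t) * Y x) \<partial>M))"
  unfolding one_plus_cos_scaleR_cis
  by (subst Bochner_Integration.integral_add)
    (auto simp: integral_scaleR_right Bochner_Integration.integral_add integrable_cis
      simp del: scaleR_add_right)

lemma integral_sin_weighted_cis:
  "(\<integral>x. (1 + sin (t * Y x)) *\<^sub>R cis (s * X x) \<partial>M) = (\<integral>x. cis (s * X x) \<partial>M)
    + (1/2) *\<^sub>R (\<i> * (\<integral>x. cis (s * X x + (- t) * Y x) \<partial>M) - \<i> * (\<integral>x. cis (s * X x + t * Y x) \<partial>M))"
  unfolding one_plus_sin_scaleR_cis
  by (subst Bochner_Integration.integral_add)
    (auto simp: integral_scaleR_right Bochner_Integration.integral_diff integrable_cis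
      simp del: scaleR_diff_right)

text \<open>Subtracting the unit weight again recovers \<open>cos\<close> and \<open>sin\<close>,
  the real and imaginary parts of \<open>cis\<close>. The right side is written entirely in
  integrals of the form treated by \<open>weighted_law_eqI\<close>.\<close>

lemma integral_indicator_cis:
  assumes [measurable]: "A \<in> sets borel"
  shows "(\<integral>x. indicator A (X x) *\<^sub>R cis (t * Y x) \<partial>M) =
      complex_of_real ((\<integral>x. (1 + cos (t * Y x)) * indicator A (X x) \<partial>M) - (\<integral>x. 1 * indicator A (X x) \<partial>M))
      + \<i> * complex_of_real ((\<integral>x. (1 + sin (t * Y x)) * indicator A (X x) \<partial>M) - (\<integral>x. 1 * indicator A (X x) \<partial>M))"
    (is "?l = of_real (?a - ?b) + \<i> * of_real (?c - ?b)")
proof -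
  have bounded: "integrable M F" if "F \<in> borel_measurable M" "\<And>x. norm (F x) \<le> 2"
    for F :: "'a \<Rightarrow> 'c::{banach, second_countable_topology}"
    using that by (intro integrable_const_bound[of _ 2]) auto
  have "?a - ?b = (\<integral>x. cos (t * Y x) * indicator A (X x) \<partial>M)"
    by (subst Bochner_Integration.integral_diff[symmetric])
      (auto intro!: bounded simp: one_plus_cos_sin_bounds abs_mult indicator_def algebra_simps)
  moreover have "?c - ?b = (\<integral>x. sin (t * Y x) * indicator A (X x) \<partial>M)"
    by (subst Bochner_Integration.integral_diff[symmetric])
      (auto intro!: bounded simp: one_plus_cos_sin_bounds abs_mult indicator_def algebra_simps)
  moreover have i: "integrable M (\<lambda>x. indicator A (X x) *\<^sub>R cis (t * Y x))"
    by (intro bounded) (auto simp: indicator_def)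
  have "Re ?l = (\<integral>x. Re (indicator A (X x) *\<^sub>R cis (t * Y x)) \<partial>M)"
    "Im ?l = (\<integral>x. Im (indicator A (X x) *\<^sub>R cis (t * Y x)) \<partial>M)"
    by (rule integral_Re[OF i, symmetric], rule integral_Im[OF i, symmetric])
  ultimately show ?thesis
    by (simp add: complex_eq_iff mult.commute)
qed

end

end

text \<open>One-dimensional uniqueness is applied twice. The weights \<open>1 + cos (t Y)\<close> and
  \<open>1 + sin (t Y)\<close> are nonnegative, and their characteristic functions along \<open>X\<close> are combinations
  of the joint one; they give the characteristic function of \<open>Y\<close> on each event \<open>X \<in> A\<close>.\<close>

lemma pair_law_eqI:
  fixes X Y :: "'a \<Rightarrow> real" and X' Y' :: "'b \<Rightarrow> real"
  assumes "prob_space M" "prob_space N"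
    and [measurable]: "X \<in> borel_measurable M" "Y \<in> borel_measurable M"
      "X' \<in> borel_measurable N" "Y' \<in> borel_measurable N"
    and eq: "\<And>s t. (\<integral>x. cis (s * X x + t * Y x) \<partial>M) = (\<integral>x. cis (s * X' x + t * Y' x) \<partial>N)"
  shows "distr M (borel \<Otimes>\<^sub>M borel) (\<lambda>x. (X x, Y x)) = distr N (borel \<Otimes>\<^sub>M borel) (\<lambda>x. (X' x, Y' x))"
proof -
  interpret M: prob_space M by fact
  interpret N: prob_space N by fact
  have iM: "integrable M F" if "F \<in> borel_measurable M" "\<And>x. norm (F x) \<le> 2"
    for F :: "'a \<Rightarrow> 'c::{banach, second_countable_topology}"
    using that by (intro M.integrable_const_bound[of _ 2]) auto
  have iN: "integrable N F" if "F \<in> borel_measurable N" "\<And>x. norm (F x) \<le> 2"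
    for F :: "'b \<Rightarrow> 'c::{banach, second_countable_topology}"
    using that by (intro N.integrable_const_bound[of _ 2]) auto
  have eq0: "(\<integral>x. cis (s * X x) \<partial>M) = (\<integral>x. cis (s * X' x) \<partial>N)" for s
    using eq[of s 0] by simp
  have rect: "measure M {x \<in> space M. X x \<in> A \<and> Y x \<in> B} = measure N {x \<in> space N. X' x \<in> A \<and> Y' x \<in> B}"
    if [measurable]: "A \<in> sets borel" "B \<in> sets borel" for A B
  proof -
    have 1: "(\<integral>x. 1 * indicator A (X x) \<partial>M) = ((\<integral>x. 1 * indicator A (X' x) \<partial>N) :: real)"
      by (rule weighted_law_eqI) (auto simp: eq0)
    have 2: "(\<integral>x. (1 + cos (t * Y x)) * indicator A (X x) \<partial>M)
           = (\<integral>x. (1 + cos (t * Y' x)) * indicator A (X' x) \<partial>N)" for t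
      by (rule weighted_law_eqI)
        (simp_all only: M.integral_cos_weighted_cis[OF assms(3,4)] N.integral_cos_weighted_cis[OF assms(5,6)] eq eq0,
          auto intro!: iM iN simp: one_plus_cos_sin_bounds)
    have 3: "(\<integral>x. (1 + sin (t * Y x)) * indicator A (X x) \<partial>M)
           = (\<integral>x. (1 + sin (t * Y' x)) * indicator A (X' x) \<partial>N)" for t
      by (rule weighted_law_eqI)
        (simp_all only: M.integral_sin_weighted_cis[OF assms(3,4)] N.integral_sin_weighted_cis[OF assms(5,6)] eq eq0,
          auto intro!: iM iN simp: one_plus_cos_sin_bounds)
    have ind: "(\<integral>x. indicator A (X x) *\<^sub>R cis (t * Y x) \<partial>M)
        = (\<integral>x. indicator A (X' x) *\<^sub>R cis (t * Y' x) \<partial>N)" for t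
      by (simp only: M.integral_indicator_cis[OF assms(3,4) that(1)]
          N.integral_indicator_cis[OF assms(5,6) that(1)] 1 2 3)
    \<comment> \<open>Second use of one-dimensional uniqueness: now along \<open>Y\<close>, with the
      indicator of \<open>X x \<in> A\<close> as the nonnegative weight.\<close>
    have "(\<integral>x. indicator A (X x) * indicator B (Y x) \<partial>M) = ((\<integral>x. indicator A (X' x) * indicator B (Y' x) \<partial>N) :: real)"
      by (rule weighted_law_eqI) (auto intro!: iM iN simp: ind simp flip: indicator_def split: split_indicator)
    moreover have "(\<integral>x. indicator A (X x) * indicator B (Y x) \<partial>M)
        = ((\<integral>x. indicator {x \<in> space M. X x \<in> A \<and> Y x \<in> B} x \<partial>M) :: real)"
      by (intro Bochner_Integration.integral_cong) (auto simp: indicator_def)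
    moreover have "(\<integral>x. indicator A (X' x) * indicator B (Y' x) \<partial>N)
        = ((\<integral>x. indicator {x \<in> space N. X' x \<in> A \<and> Y' x \<in> B} x \<partial>N) :: real)"
      by (intro Bochner_Integration.integral_cong) (auto simp: indicator_def)
    ultimately show ?thesis by (simp add: Int_absorb2)
  qed
  show ?thesis
  proof (rule measure_eqI_generator_eq[where A = "\<lambda>_. UNIV"])
    let ?E = "{A \<times> B | A B. A \<in> sets (borel :: real measure) \<and> B \<in> sets (borel :: real measure)}"
    show "Int_stable ?E"
      by (rule Int_stable_pair_measure_generator)
    show "?E \<subseteq> Pow UNIV" by auto
    show "sets (distr M (borel \<Otimes>\<^sub>M borel) (\<lambda>x. (X x, Y x))) = sigma_sets UNIV ?E"
      "sets (distr N (borel \<Otimes>\<^sub>M borel) (\<lambda>x. (X' x, Y' x))) = sigma_sets UNIV ?E"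
      by (auto simp: sets_pair_measure)
    show "range (\<lambda>_. UNIV) \<subseteq> ?E" by (auto intro!: exI[of _ UNIV])
    show "emeasure (distr M (borel \<Otimes>\<^sub>M borel) (\<lambda>x. (X x, Y x))) UNIV \<noteq> \<infinity>"
      unfolding infinity_ennreal_def
      by (intro finite_measure.emeasure_finite finite_measure.finite_measure_distr M.finite_measure_axioms) simp
    fix Z assume "Z \<in> ?E"
    then obtain A B where Z: "Z = A \<times> B" and [measurable]: "A \<in> sets borel" "B \<in> sets borel" by blast
    have "(\<lambda>x. (X x, Y x)) -` Z \<inter> space M = {x \<in> space M. X x \<in> A \<and> Y x \<in> B}"
      "(\<lambda>x. (X' x, Y' x)) -` Z \<inter> space N = {x \<in> space N. X' x \<in> A \<and> Y' x \<in> B}" using Z by auto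
    then show "emeasure (distr M (borel \<Otimes>\<^sub>M borel) (\<lambda>x. (X x, Y x))) Z
      = emeasure (distr N (borel \<Otimes>\<^sub>M borel) (\<lambda>x. (X' x, Y' x))) Z"
      using rect[of A B] by (simp add: Z emeasure_distr M.emeasure_eq_measure N.emeasure_eq_measure)
  qed auto
qed

section \<open>Quantiles and trimmed intervals\<close>

context prob_space
begin

context
  fixes W :: "'a \<Rightarrow> real"
  assumes W[measurable]: "W \<in> borel_measurable M"
begin

text \<open>The limits of the distribution function at both ends make the set under the infimum
  nonempty and bounded below; right continuity makes the infimum belong to it. All later facts on
  quantiles go through this Galois connection.\<close>

lemma quantile_le_iff:
  assumes p: "0 < p" "p < 1"
  shows "quantile M W p \<le> x \<longleftrightarrow> p \<le> prob {\<omega> \<in> space M. W \<omega> \<le> x}"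
proof -
  interpret D: real_distribution "distr M borel W" by simp
  let ?F = "cdf (distr M borel W)"
  have F: "prob {\<omega> \<in> space M. W \<omega> \<le> x} = ?F x" for x
    by (auto simp: cdf_def2 measure_distr intro!: arg_cong[where f=prob])
  define A where "A = {x. p \<le> ?F x}"
  have q: "quantile M W p = Inf A"
    unfolding quantile_def A_def F ..
  have "eventually (\<lambda>x. ?F x > p) at_top"
    using D.cdf_lim_at_top_prob p by (intro order_tendstoD)
  then obtain y where "?F y > p" by (metis eventually_at_top_linorder order_refl)
  then have ne: "A \<noteq> {}" by (auto simp: A_def intro: less_imp_le)
  have "eventually (\<lambda>x. ?F x < p) at_bot"
    using D.cdf_lim_at_bot p by (intro order_tendstoD) auto
  then obtain z where z: "?F z < p" by (metis eventually_at_bot_linorder order_refl)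
  have "z \<le> x" if "x \<in> A" for x
    using that z D.cdf_nondecreasing[of x z] by (fastforce simp: A_def)
  then have bdd: "bdd_below A" by (meson bdd_belowI)
  have "p \<le> ?F (Inf A)"
  proof (rule tendsto_lowerbound)
    show "(?F \<longlongrightarrow> ?F (Inf A)) (at_right (Inf A))"
      using D.cdf_is_right_cont by (simp add: continuous_within)
    show "eventually (\<lambda>x. p \<le> ?F x) (at_right (Inf A))"
      unfolding eventually_at_right_field
    proof (intro exI[of _ "Inf A + 1"] conjI allI impI)
      fix x assume "Inf A < x"
      then obtain y where "y \<in> A" "y < x" using ne bdd by (metis cInf_less_iff)
      then show "p \<le> ?F x" using D.cdf_nondecreasing[of y x] by (auto simp: A_def)
    qed simp
  qed simp
  then have "Inf A \<le> x \<Longrightarrow> p \<le> ?F x"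
    using D.cdf_nondecreasing order_trans by blast
  moreover have "p \<le> ?F x \<Longrightarrow> Inf A \<le> x"
    using bdd by (auto simp: A_def intro: cInf_lower)
  ultimately show ?thesis unfolding q F by blast
qed

lemma prob_le_quantile: "0 < p \<Longrightarrow> p < 1 \<Longrightarrow> p \<le> prob {\<omega> \<in> space M. W \<omega> \<le> quantile M W p}"
  using quantile_le_iff by blast

text \<open>To the left of the quantile the distribution function stays below \<open>p\<close>,
  hence so does its left limit, up to equality.\<close>

lemma prob_less_quantile:
  assumes p: "0 < p" "p < 1"
  shows "prob {\<omega> \<in> space M. W \<omega> < quantile M W p} \<le> p"
proof -
  interpret D: real_distribution "distr M borel W" by simp
  let ?F = "cdf (distr M borel W)" and ?q = "quantile M W p"
  have F: "prob {\<omega> \<in> space M. W \<omega> \<le> x} = ?F x" for x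
    by (auto simp: cdf_def2 measure_distr intro!: arg_cong[where f=prob])
  have "measure (distr M borel W) {..<?q} \<le> p"
  proof (rule tendsto_upperbound[OF D.cdf_at_left])
    show "eventually (\<lambda>x. ?F x \<le> p) (at_left ?q)"
      unfolding eventually_at_left_field using quantile_le_iff[OF p]
      by (intro exI[of _ "?q - 1"]) (simp add: F, meson linear not_le)
  qed simp
  moreover have "measure (distr M borel W) {..<?q} = prob {\<omega> \<in> space M. W \<omega> < ?q}"
    by (auto simp: measure_distr intro!: arg_cong[where f=prob])
  ultimately show ?thesis by simp
qed

lemma quantile_affine:
  assumes p: "0 < p" "p < 1" and b: "0 < b"
  shows "quantile M (\<lambda>\<omega>. a + b * W \<omega>) p = a + b * quantile M W p"
proof -
  have "quantile M (\<lambda>\<omega>. a + b * W \<omega>) p \<le> x \<longleftrightarrow> a + b * quantile M W p \<le> x" for x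
  proof -
    have "quantile M (\<lambda>\<omega>. a + b * W \<omega>) p \<le> x \<longleftrightarrow> p \<le> prob {\<omega> \<in> space M. a + b * W \<omega> \<le> x}"
      by (rule prob_space.quantile_le_iff) (auto intro: p prob_space_axioms)
    also have "{\<omega> \<in> space M. a + b * W \<omega> \<le> x} = {\<omega> \<in> space M. W \<omega> \<le> (x - a) / b}"
      using b by (auto simp: field_simps)
    also have "p \<le> prob \<dots> \<longleftrightarrow> quantile M W p \<le> (x - a) / b"
      using quantile_le_iff[OF p] by simp
    also have "\<dots> \<longleftrightarrow> a + b * quantile M W p \<le> x"
      using b by (auto simp: field_simps)
    finally show ?thesis .
  qed
  then show ?thesis by (metis order_antisym order_refl)
qed

lemma tint_affine_iff:
  assumes "0 < \<alpha>" "\<alpha> < 1" "0 < b"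
  shows "a + b * x \<in> tint M (\<lambda>\<omega>. a + b * W \<omega>) \<alpha> \<longleftrightarrow> x \<in> tint M W \<alpha>"
  using assms by (simp add: tint_def quantile_affine)

text \<open>The event below the upper quantile is covered by the trimmed event and the part strictly
  below the lower quantile, which has mass at most \<open>\<alpha> / 2\<close>. In particular every
  conditioning event has positive probability.\<close>

lemma prob_tint_ge:
  assumes \<alpha>: "0 < \<alpha>" "\<alpha> < 1"
  shows "1 - \<alpha> \<le> prob {\<omega> \<in> space M. W \<omega> \<in> tint M W \<alpha>}"
proof -
  let ?l = "quantile M W (\<alpha>/2)" and ?r = "quantile M W (1 - \<alpha>/2)"
  have "prob {\<omega> \<in> space M. W \<omega> \<le> ?r}
      \<le> prob ({\<omega> \<in> space M. W \<omega> < ?l} \<union> {\<omega> \<in> space M. W \<omega> \<in> tint M W \<alpha>})"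
    by (intro finite_measure_mono) (auto simp: tint_def)
  also have "\<dots> \<le> prob {\<omega> \<in> space M. W \<omega> < ?l} + prob {\<omega> \<in> space M. W \<omega> \<in> tint M W \<alpha>}"
    by (intro measure_subadditive) (auto simp: tint_def)
  finally show ?thesis
    using prob_le_quantile[of "1 - \<alpha>/2"] prob_less_quantile[of "\<alpha>/2"] \<alpha> by simp
qed

text \<open>The left-continuous quantiles of a symmetric law need not be symmetric: where the
  distribution function is flat, \<^term>\<open>quantile M W (\<alpha> / 2)\<close> is the left end of the flat
  piece, while \<^term>\<open>- quantile M W (1 - \<alpha> / 2)\<close> is its right end. The two trimmed events then
  differ by an atom at the left end at most.\<close>

lemma AE_tint_symmetric:
  assumes \<alpha>: "0 < \<alpha>" "\<alpha> < 1"
    and sym: "\<And>x. prob {\<omega> \<in> space M. W \<omega> \<le> x} = prob {\<omega> \<in> space M. - W \<omega> \<le> x}"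
    and no_atom: "\<And>a. a \<noteq> 0 \<Longrightarrow> prob {\<omega> \<in> space M. W \<omega> = a} = 0"
  shows "AE \<omega> in M. W \<omega> \<in> tint M W \<alpha> \<longleftrightarrow> \<bar>W \<omega>\<bar> \<le> quantile M W (1 - \<alpha> / 2)"
proof -
  define l r where "l = quantile M W (\<alpha>/2)" and "r = quantile M W (1 - \<alpha>/2)"
  \<comment> \<open>By symmetry this is the mass of \<open>W \<ge> l\<close>, which is at least
    \<open>1 - \<alpha> / 2\<close>; hence the upper quantile \<open>r\<close> is at most
    \<open>- l\<close>.\<close>
  have "prob {\<omega> \<in> space M. W \<omega> \<le> - l} = 1 - prob {\<omega> \<in> space M. W \<omega> < l}"
    unfolding sym by (subst prob_compl[symmetric]) (auto intro!: arg_cong[where f=prob])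
  then have rl: "r \<le> - l"
    unfolding r_def using \<alpha> prob_less_quantile[of "\<alpha>/2"] by (simp add: quantile_le_iff l_def)
  have r_ge: "1 - \<alpha>/2 \<le> prob {\<omega> \<in> space M. W \<omega> \<le> r}"
    using prob_le_quantile[of "1 - \<alpha>/2"] \<alpha> by (simp add: r_def)
  have l_ge: "\<alpha>/2 \<le> prob {\<omega> \<in> space M. W \<omega> \<le> l}"
    using prob_le_quantile[of "\<alpha>/2"] \<alpha> by (simp add: l_def)
  have lr: "l \<le> r"
    unfolding l_def using \<alpha> r_ge by (simp add: quantile_le_iff)
  show ?thesis
  proof (cases "l = - r")
    case True
    then show ?thesis by (auto simp: tint_def l_def r_def)
  next
    case False
    \<comment> \<open>The sign of \<open>l\<close> matters because only atoms away from the origin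
      are excluded.\<close>
    with rl lr have *: "l < - r" "l < 0" by linarith+
    \<comment> \<open>The values below \<open>- r\<close> carry mass at most
      \<open>\<alpha> / 2\<close>, and those up to \<open>l\<close> already use all of it. So the
      open gap between \<open>l\<close> and \<open>- r\<close> is null.\<close>
    have "prob {\<omega> \<in> space M. W \<omega> < - r} = 1 - prob {\<omega> \<in> space M. - W \<omega> \<le> r}"
      by (subst prob_compl[symmetric]) (auto intro!: arg_cong[where f=prob])
    then have "prob {\<omega> \<in> space M. W \<omega> < - r} \<le> \<alpha>/2"
      using r_ge by (simp add: sym)
    moreover have "prob {\<omega> \<in> space M. W \<omega> < - r}
        = prob {\<omega> \<in> space M. W \<omega> \<le> l} + prob {\<omega> \<in> space M. l < W \<omega> \<and> W \<omega> < - r}"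
      using * by (subst finite_measure_Union[symmetric]) (auto intro!: arg_cong[where f=prob])
    ultimately have "prob {\<omega> \<in> space M. l < W \<omega> \<and> W \<omega> < - r} = 0"
      using l_ge measure_nonneg[of M "{\<omega> \<in> space M. l < W \<omega> \<and> W \<omega> < - r}"] by linarith
    then have "AE \<omega> in M. \<not> (l < W \<omega> \<and> W \<omega> < - r)"
      by (subst (asm) prob_eq_0) auto
    moreover have "AE \<omega> in M. W \<omega> \<noteq> l"
      using no_atom[of l, THEN prob_eq_0[THEN iffD1, rotated]] * by auto
    ultimately show ?thesis
      by eventually_elim (use * in \<open>auto simp: tint_def l_def[symmetric] r_def[symmetric]\<close>)
  qed
qed

end

end

section \<open>Projections of an elliptical vector\<close>

text \<open>Eliminating \<open>s\<close> from the two equations leaves a quadratic in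
  \<open>c\<close>, nonzero because the line misses the origin. Since \<open>c\<close> is injective,
  its roots bound the number of indices.\<close>

lemma card_circle_line_le_2:
  fixes x y a :: real
  assumes "a \<noteq> 0" and inj: "inj_on c I" and circle: "\<And>n. n \<in> I \<Longrightarrow> (c n)\<^sup>2 + (s n)\<^sup>2 = 1"
    and line: "\<And>n. n \<in> I \<Longrightarrow> c n * x + s n * y = a"
  shows "card I \<le> 2"
proof -
  let ?p = "[: a\<^sup>2 - y\<^sup>2, - 2 * a * x, x\<^sup>2 + y\<^sup>2 :]"
  have ne: "?p \<noteq> 0" if "I \<noteq> {}"
  proof
    assume "?p = 0"
    then have "x = 0" "y = 0" by auto
    with that line \<open>a \<noteq> 0\<close> show False by auto
  qed
  have root: "poly ?p (c n) = 0" if "n \<in> I" for n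
  proof -
    have "(a - c n * x)\<^sup>2 = (s n)\<^sup>2 * y\<^sup>2"
      using line[OF that] by (metis add_diff_cancel_left' power_mult_distrib)
    also have "\<dots> = (1 - (c n)\<^sup>2) * y\<^sup>2"
      using circle[OF that] by (metis add_diff_cancel_left')
    finally show ?thesis by (simp add: power2_eq_square algebra_simps)
  qed
  show ?thesis
  proof (cases "I = {}")
    case False
    have "card I = card (c ` I)" using inj by (simp add: card_image)
    also have "\<dots> \<le> card {z. poly ?p z = 0}"
      using root poly_roots_finite[OF ne[OF False]] by (intro card_mono) auto
    also have "\<dots> \<le> degree ?p" by (intro card_poly_roots_bound ne False)
    also have "\<dots> \<le> 2" by (auto intro: degree_pCons_le order_trans)
    finally show ?thesis .
  qed simp
qed

lemma square_integrable_mult: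
  fixes f g :: "'a \<Rightarrow> real"
  assumes [measurable]: "f \<in> borel_measurable M" "g \<in> borel_measurable M"
    and "integrable M (\<lambda>\<omega>. (f \<omega>)\<^sup>2)" "integrable M (\<lambda>\<omega>. (g \<omega>)\<^sup>2)"
  shows "integrable M (\<lambda>\<omega>. f \<omega> * g \<omega>)"
proof (rule Bochner_Integration.integrable_bound)
  show "integrable M (\<lambda>\<omega>. (f \<omega>)\<^sup>2 + (g \<omega>)\<^sup>2)" using assms by auto
  show "AE \<omega> in M. norm (f \<omega> * g \<omega>) \<le> norm ((f \<omega>)\<^sup>2 + (g \<omega>)\<^sup>2)"
  proof (rule AE_I2)
    fix \<omega>
    have "2 * (\<bar>f \<omega>\<bar> * \<bar>g \<omega>\<bar>) \<le> (f \<omega>)\<^sup>2 + (g \<omega>)\<^sup>2"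
      using sum_squares_bound[of "\<bar>f \<omega>\<bar>" "\<bar>g \<omega>\<bar>"] by (simp add: mult.assoc)
    moreover have "0 \<le> \<bar>f \<omega>\<bar> * \<bar>g \<omega>\<bar>" by simp
    ultimately have "\<bar>f \<omega>\<bar> * \<bar>g \<omega>\<bar> \<le> (f \<omega>)\<^sup>2 + (g \<omega>)\<^sup>2" by linarith
    then show "norm (f \<omega> * g \<omega>) \<le> norm ((f \<omega>)\<^sup>2 + (g \<omega>)\<^sup>2)" by (simp add: abs_mult)
  qed
qed simp

locale elliptical_vector = prob_space M for M :: "'a measure" +
  fixes X :: "'a \<Rightarrow> real^'d" and \<mu> :: "real^'d" and S :: "real^'d^'d" and \<phi> :: "real \<Rightarrow> complex"
  assumes X_measurable [measurable]: "X \<in> borel_measurable M"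
    and square_integrable: "\<And>j. integrable M (\<lambda>\<omega>. (X \<omega> $ j)\<^sup>2)"
    and elliptical_X: "elliptical M X \<mu> S \<phi>"
    and symmetric_scatter: "transpose S = S"
    and pos_def: "\<And>v. v \<noteq> 0 \<Longrightarrow> v \<bullet> (S *v v) > 0"
begin

text \<open>Centring at \<open>\<mu>\<close> cancels the phase factor of the characteristic
  function.\<close>

definition proj :: "real^'d \<Rightarrow> 'a \<Rightarrow> real" where
  "proj u \<omega> = u \<bullet> (X \<omega> - \<mu>)"

definition gram :: "real^'d \<Rightarrow> real^'d \<Rightarrow> real" where
  "gram u v = u \<bullet> (S *v v)"

lemma gram_commute: "gram u v = gram v u"
proof -
  have "gram u v = (S *v u) \<bullet> v"
    unfolding gram_def by (metis dot_lmul_matrix symmetric_scatter transpose_matrix_vector)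
  then show ?thesis by (simp add: gram_def inner_commute)
qed

lemma gram_bilinear:
  "gram (u + v) w = gram u w + gram v w" "gram w (u + v) = gram w u + gram w v"
  "gram (u - v) w = gram u w - gram v w" "gram w (u - v) = gram w u - gram w v"
  "gram (a *\<^sub>R u) w = a * gram u w" "gram w (a *\<^sub>R u) = a * gram w u"
  "gram (- u) w = - gram u w" "gram w (- u) = - gram w u" "gram 0 w = 0" "gram w 0 = 0"
proof -
  show 1: "gram (u + v) w = gram u w + gram v w" for u v w by (simp add: gram_def inner_simps)
  show 2: "gram (u - v) w = gram u w - gram v w" for u v w by (simp add: gram_def inner_simps)
  show 3: "gram (a *\<^sub>R u) w = a * gram u w" for u w a by (simp add: gram_def inner_simps)
  show 4: "gram (- u) w = - gram u w" for u w by (simp add: gram_def inner_simps)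
  show 5: "gram 0 w = 0" for w by (simp add: gram_def)
  show "gram w (u + v) = gram w u + gram w v" "gram w (u - v) = gram w u - gram w v"
    "gram w (a *\<^sub>R u) = a * gram w u" "gram w (- u) = - gram w u" "gram w 0 = 0"
    unfolding gram_commute[of w] 1 2 3 4 5 by rule+
qed

lemma proj_linear:
  "proj (u + v) \<omega> = proj u \<omega> + proj v \<omega>" "proj (u - v) \<omega> = proj u \<omega> - proj v \<omega>"
  "proj (a *\<^sub>R u) \<omega> = a * proj u \<omega>" "proj (- u) \<omega> = - proj u \<omega>" "proj 0 \<omega> = 0"
  by (simp_all add: proj_def inner_simps algebra_simps)

lemma proj_measurable [measurable]: "proj u \<in> borel_measurable M"
  unfolding proj_def by measurable

lemma proj_integrable: "integrable M (proj u)" "integrable M (\<lambda>\<omega>. proj u \<omega> * proj w \<omega>)"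
proof -
  have comp[measurable]: "(\<lambda>\<omega>. X \<omega> $ j) \<in> borel_measurable M" for j
    unfolding cart_eq_inner_axis by measurable
  have X1: "integrable M (\<lambda>\<omega>. X \<omega> $ j)" for j
    using square_integrable_mult[of "\<lambda>\<omega>. X \<omega> $ j" M "\<lambda>_. 1"] square_integrable by simp
  have XX: "integrable M (\<lambda>\<omega>. X \<omega> $ j * X \<omega> $ k)" for j k
    using square_integrable by (intro square_integrable_mult) auto
  have "integrable M (\<lambda>\<omega>. (X \<omega> $ j - \<mu> $ j) * (X \<omega> $ k - \<mu> $ k))" for j k
    using X1 XX by (simp add: algebra_simps)
  moreover have "proj u \<omega> * proj w \<omega>
      = (\<Sum>j\<in>UNIV. \<Sum>k\<in>UNIV. (u $ j * w $ k) * ((X \<omega> $ j - \<mu> $ j) * (X \<omega> $ k - \<mu> $ k)))" for \<omega>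
    by (simp add: proj_def inner_vec_def sum_product ac_simps)
  ultimately show "integrable M (\<lambda>\<omega>. proj u \<omega> * proj w \<omega>)" by simp
  have "proj u = (\<lambda>\<omega>. \<Sum>j\<in>UNIV. u $ j * (X \<omega> $ j - \<mu> $ j))"
    by (simp add: proj_def inner_vec_def fun_eq_iff)
  then show "integrable M (proj u)" using X1 by simp
qed

text \<open>A combination of two projections is the projection onto
  \<open>s *\<^sub>R u + t *\<^sub>R w\<close>, whose quadratic form expands into three Gram
  entries. Hence these entries determine the joint law.\<close>

lemma char_proj: "(\<integral>\<omega>. cis (s * proj u \<omega> + t * proj w \<omega>) \<partial>M)
  = \<phi> (s\<^sup>2 * gram u u + 2 * s * t * gram u w + t\<^sup>2 * gram w w)"
proof -
  define v where "v = s *\<^sub>R u + t *\<^sub>R w"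
  have "s * proj u \<omega> + t * proj w \<omega> = - (v \<bullet> \<mu>) + v \<bullet> X \<omega>" for \<omega>
    by (simp add: v_def proj_def inner_simps algebra_simps)
  then have "(\<integral>\<omega>. cis (s * proj u \<omega> + t * proj w \<omega>) \<partial>M) = (\<integral>\<omega>. cis (- (v \<bullet> \<mu>)) * cis (v \<bullet> X \<omega>) \<partial>M)"
    by (simp only: cis_mult)
  also have "\<dots> = cis (- (v \<bullet> \<mu>)) * (\<integral>\<omega>. cis (v \<bullet> X \<omega>) \<partial>M)" by simp
  also have "\<dots> = (cis (- (v \<bullet> \<mu>)) * cis (v \<bullet> \<mu>)) * \<phi> (gram v v)"
    using elliptical_X by (simp add: elliptical_def gram_def)
  also have "\<dots> = \<phi> (gram v v)" by (simp add: cis_mult del: cis_neq_zero)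
  also have "gram v v = s\<^sup>2 * gram u u + 2 * s * t * gram u w + t\<^sup>2 * gram w w"
    by (simp add: v_def gram_bilinear gram_commute[of w u] power2_eq_square algebra_simps)
  finally show ?thesis .
qed

lemma pair_law_cong:
  assumes "gram u u = gram u' u'" "gram u w = gram u' w'" "gram w w = gram w' w'"
  shows "distr M (borel \<Otimes>\<^sub>M borel) (\<lambda>\<omega>. (proj u \<omega>, proj w \<omega>))
    = distr M (borel \<Otimes>\<^sub>M borel) (\<lambda>\<omega>. (proj u' \<omega>, proj w' \<omega>))"
  by (rule pair_law_eqI) (auto simp: char_proj assms prob_space_axioms)

lemma expectation_cong:
  fixes F :: "real \<times> real \<Rightarrow> real"
  assumes "gram u u = gram u' u'" "gram u w = gram u' w'" "gram w w = gram w' w'"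
    and [measurable]: "F \<in> borel_measurable (borel \<Otimes>\<^sub>M borel)"
  shows "(\<integral>\<omega>. F (proj u \<omega>, proj w \<omega>) \<partial>M) = (\<integral>\<omega>. F (proj u' \<omega>, proj w' \<omega>) \<partial>M)"
  using arg_cong[OF pair_law_cong[OF assms(1-3)], of "\<lambda>D. integral\<^sup>L D F"]
  by (simp add: integral_distr)

lemma prob_cong:
  assumes "gram u u = gram u' u'" and [measurable]: "A \<in> sets borel"
  shows "prob {\<omega> \<in> space M. proj u \<omega> \<in> A} = prob {\<omega> \<in> space M. proj u' \<omega> \<in> A}"
proof -
  \<comment> \<open>Pairing with the projection onto the zero vector, all of whose Gram entries
    vanish, reduces a one-dimensional law to a pair.\<close>
  have *: "prob {\<omega> \<in> space M. proj u \<omega> \<in> A} = (\<integral>\<omega>. indicator A (fst (proj u \<omega>, proj 0 \<omega>)) \<partial>M)" for u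
  proof -
    have "(\<integral>\<omega>. indicator A (fst (proj u \<omega>, proj 0 \<omega>)) \<partial>M)
        = (\<integral>\<omega>. indicator {\<omega> \<in> space M. proj u \<omega> \<in> A} \<omega> \<partial>M :: real)"
      by (intro Bochner_Integration.integral_cong) (auto simp: indicator_def)
    then show ?thesis by (simp add: Int_absorb2)
  qed
  show ?thesis unfolding *
    using expectation_cong[of u u' 0 0 "\<lambda>p. indicator A (fst p)"] assms(1) by (simp add: gram_bilinear)
qed

lemma tint_cong:
  assumes "gram u u = gram u' u'"
  shows "tint M (proj u) \<alpha> = tint M (proj u') \<alpha>"
  using prob_cong[OF assms, of "{..x}" for x] by (simp add: tint_def quantile_def)

text \<open>If \<^term>\<open>proj u\<close> had an atom at \<^term>\<open>a\<close>, so would the projections onto all unit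
  combinations of \<^term>\<open>u\<close> and \<^term>\<open>w\<close>; but a line off the origin meets the circle at
  most twice.\<close>

lemma proj_no_atom:
  assumes "gram u u = 1" "gram w w = 1" "gram u w = 0" "a \<noteq> 0"
  shows "prob {\<omega> \<in> space M. proj u \<omega> = a} = 0"
proof -
  \<comment> \<open>Any sequence of distinct abscissas in the unit interval would do; it yields
    infinitely many unit vectors in the plane of \<open>u\<close> and \<open>w\<close>.\<close>
  define c s where "c n = 1 / real (n + 1)" and "s n = sqrt (1 - (c n)\<^sup>2)" for n :: nat
  define v where "v n = c n *\<^sub>R u + s n *\<^sub>R w" for n
  have "\<bar>c n\<bar> \<le> 1" for n by (simp add: c_def)
  then have circle: "(c n)\<^sup>2 + (s n)\<^sup>2 = 1" for n by (simp add: s_def abs_square_le_1)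
  have inj: "inj_on c I" for I by (auto simp: inj_on_def c_def)
  have gram_v: "gram (v n) (v n) = 1" for n
    using circle[of n] assms
    by (simp add: v_def gram_bilinear gram_commute[of w u] power2_eq_square)
  define E where "E n = {\<omega> \<in> space M. proj (v n) \<omega> = a}" for n
  have [measurable]: "E n \<in> sets M" for n by (simp add: E_def)
  have E: "prob (E n) = prob {\<omega> \<in> space M. proj u \<omega> = a}" for n
    using prob_cong[of "v n" u "{a}"] gram_v assms by (simp add: E_def)
  \<comment> \<open>The \<open>K\<close> events \<open>E n\<close> are equally likely and each
    outcome lies in at most two of them, so the expected number of occurrences is at most 2 for
    every \<open>K\<close>.\<close>
  have "real K * prob {\<omega> \<in> space M. proj u \<omega> = a} \<le> 2" for K
  proof -
    have "real K * prob {\<omega> \<in> space M. proj u \<omega> = a} = (\<Sum>n<K. prob (E n))" by (simp add: E)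
    also have "\<dots> = (\<integral>\<omega>. (\<Sum>n<K. indicator (E n) \<omega>) \<partial>M)"
      by (subst Bochner_Integration.integral_sum) (auto simp: Int_absorb2 sets.sets_into_space less_top[symmetric] intro!: integrable_real_indicator)
    also have "\<dots> \<le> (\<integral>\<omega>. 2 \<partial>M)"
    proof (intro integral_mono)
      fix \<omega>
      have "(\<Sum>n<K. indicator (E n) \<omega>) = real (card {n. n < K \<and> \<omega> \<in> E n})"
        by (simp add: indicator_def sum.If_cases Int_def flip: of_bool_def)
      moreover have "card {n. n < K \<and> \<omega> \<in> E n} \<le> 2"
        by (rule card_circle_line_le_2[OF \<open>a \<noteq> 0\<close> inj circle, where x = "proj u \<omega>" and y = "proj w \<omega>"])
          (simp add: E_def v_def proj_linear)
      ultimately show "(\<Sum>n<K. indicator (E n) \<omega>) \<le> (2::real)" by simp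
    qed (auto simp: less_top[symmetric] intro!: Bochner_Integration.integrable_sum integrable_real_indicator)
    finally show ?thesis by (simp add: prob_space)
  qed
  then have "\<not> prob {\<omega> \<in> space M. proj u \<omega> = a} > 0"
    using reals_Archimedean3[of "prob {\<omega> \<in> space M. proj u \<omega> = a}"] by (meson not_le)
  then show ?thesis using measure_nonneg[of M "{\<omega> \<in> space M. proj u \<omega> = a}"] by linarith
qed

end

section \<open>Trimmed variances\<close>

lemma cexp_cmult: "cexp M A (\<lambda>\<omega>. a * f \<omega>) = a * cexp M A f"
proof -
  have "(\<integral>\<omega>. indicator A \<omega> * (a * f \<omega>) \<partial>M) = (\<integral>\<omega>. a * (indicator A \<omega> * f \<omega>) \<partial>M)"
    by (simp only: mult.left_commute)
  then show ?thesis by (simp add: cexp_def)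
qed

context finite_measure
begin

context
  fixes A :: "'a set"
  assumes A: "A \<in> sets M"
begin

lemma integrable_indicator_mult:
  fixes f :: "'a \<Rightarrow> real"
  assumes "integrable M f"
  shows "integrable M (\<lambda>\<omega>. indicator A \<omega> * f \<omega>)"
  using integrable_mult_indicator[OF A assms] by simp

lemma cexp_linear:
  assumes "integrable M f" "integrable M g"
  shows "cexp M A (\<lambda>\<omega>. f \<omega> + g \<omega>) = cexp M A f + cexp M A g"
    "cexp M A (\<lambda>\<omega>. f \<omega> - g \<omega>) = cexp M A f - cexp M A g"
  by (simp_all add: cexp_def distrib_left right_diff_distrib integrable_indicator_mult assms
      add_divide_distrib diff_divide_distrib)

lemma cexp_const:
  assumes "measure M A > 0"
  shows "cexp M A (\<lambda>\<omega>. a) = a"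
  using assms A by (simp add: cexp_def Int_absorb2 sets.sets_into_space)

end

end

context elliptical_vector
begin

definition trim :: "real \<Rightarrow> real^'d \<Rightarrow> 'a set" where
  "trim \<alpha> u = {\<omega> \<in> space M. proj u \<omega> \<in> tint M (proj u) \<alpha>}"

lemma trim_sets [measurable]: "trim \<alpha> u \<in> sets M"
  unfolding trim_def tint_def by measurable

text \<open>The coordinate is an increasing affine function of the standardised projection, and
  trimmed intervals follow such maps.\<close>

lemma tevent_eq_trim:
  assumes \<alpha>: "0 < \<alpha>" "\<alpha> < 1" and p: "P $ j \<noteq> 0"
  shows "tevent M (\<lambda>\<omega>. P *v X \<omega>) j \<alpha> = trim \<alpha> ((P $ j) /\<^sub>R sqrt (gram (P $ j) (P $ j)))"
proof -
  define b where "b = sqrt (gram (P $ j) (P $ j))"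
  have b: "b > 0" using pos_def[OF p] by (simp add: b_def gram_def)
  have "(P *v X \<omega>) $ j = P $ j \<bullet> \<mu> + b * proj ((P $ j) /\<^sub>R b) \<omega>" for \<omega>
    using b by (simp add: matrix_vector_mul_component proj_def inner_simps field_simps)
  then show ?thesis
    unfolding tevent_def trim_def b_def[symmetric] using \<alpha> b by (simp add: tint_affine_iff)
qed

lemma cexp_trim_cong:
  fixes F :: "real \<times> real \<Rightarrow> real"
  assumes g: "gram u u = gram u' u'" "gram u w = gram u' w'" "gram w w = gram w' w'"
    and [measurable]: "F \<in> borel_measurable (borel \<Otimes>\<^sub>M borel)"
  shows "cexp M (trim \<alpha> u) (\<lambda>\<omega>. F (proj u \<omega>, proj w \<omega>))
       = cexp M (trim \<alpha> u') (\<lambda>\<omega>. F (proj u' \<omega>, proj w' \<omega>))"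
proof -
  let ?T = "tint M (proj u) \<alpha>"
  have [measurable]: "?T \<in> sets borel" by (simp add: tint_def)
  note T = tint_cong[OF g(1), of \<alpha>]
  have "(\<integral>\<omega>. indicator (trim \<alpha> u) \<omega> * F (proj u \<omega>, proj w \<omega>) \<partial>M)
      = (\<integral>\<omega>. (\<lambda>p. indicator ?T (fst p) * F p) (proj u \<omega>, proj w \<omega>) \<partial>M)"
    by (intro Bochner_Integration.integral_cong) (auto simp: trim_def indicator_def)
  also have "\<dots> = (\<integral>\<omega>. (\<lambda>p. indicator ?T (fst p) * F p) (proj u' \<omega>, proj w' \<omega>) \<partial>M)"
    by (intro expectation_cong g) measurable
  also have "\<dots> = (\<integral>\<omega>. indicator (trim \<alpha> u') \<omega> * F (proj u' \<omega>, proj w' \<omega>) \<partial>M)"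
    by (intro Bochner_Integration.integral_cong) (auto simp: trim_def indicator_def T)
  finally have "(\<integral>\<omega>. indicator (trim \<alpha> u) \<omega> * F (proj u \<omega>, proj w \<omega>) \<partial>M)
    = (\<integral>\<omega>. indicator (trim \<alpha> u') \<omega> * F (proj u' \<omega>, proj w' \<omega>) \<partial>M)" .
  moreover have "measure M (trim \<alpha> u) = measure M (trim \<alpha> u')"
    unfolding trim_def T[symmetric] by (intro prob_cong g) simp
  ultimately show ?thesis by (simp add: cexp_def)
qed

text \<open>Replacing \<open>w\<close> by \<open>- w\<close> preserves all Gram entries, so both
  expectations equal their own negatives.\<close>

lemma cexp_trim_orthogonal:
  assumes "gram u w = 0"
  shows "cexp M (trim \<alpha> u) (proj w) = 0" "cexp M (trim \<alpha> u) (\<lambda>\<omega>. proj u \<omega> * proj w \<omega>) = 0"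
proof -
  have *: "cexp M A (\<lambda>\<omega>. - f \<omega>) = - cexp M A f" for A and f :: "'a \<Rightarrow> real"
    by (simp add: cexp_def)
  show "cexp M (trim \<alpha> u) (proj w) = 0"
    using cexp_trim_cong[of u u w "- w" snd \<alpha>] assms by (simp add: gram_bilinear proj_linear *)
  show "cexp M (trim \<alpha> u) (\<lambda>\<omega>. proj u \<omega> * proj w \<omega>) = 0"
    using cexp_trim_cong[of u u w "- w" "\<lambda>p. fst p * snd p" \<alpha>] assms
    by (simp add: gram_bilinear proj_linear *)
qed

definition trimmed_variance :: "real \<Rightarrow> real^'d \<Rightarrow> real^'d \<Rightarrow> real" where
  "trimmed_variance \<alpha> u v = cexp M (trim \<alpha> u) (\<lambda>\<omega>. (proj v \<omega> - cexp M (trim \<alpha> u) (proj v))\<^sup>2)"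

lemma trimmed_variance_cong:
  assumes "gram u u = gram u' u'" "gram u w = gram u' w'" "gram w w = gram w' w'"
  shows "trimmed_variance \<alpha> u w = trimmed_variance \<alpha> u' w'"
proof -
  have "cexp M (trim \<alpha> u) (proj w) = cexp M (trim \<alpha> u') (proj w')"
    using cexp_trim_cong[OF assms, of snd \<alpha>] by simp
  then show ?thesis
    unfolding trimmed_variance_def
    using cexp_trim_cong[OF assms, of "\<lambda>p. (snd p - cexp M (trim \<alpha> u) (proj w))\<^sup>2" \<alpha>] by simp
qed

context
  fixes \<alpha> :: real
  assumes \<alpha>: "0 < \<alpha>" "\<alpha> < 1"
begin

lemma prob_trim_pos: "prob (trim \<alpha> u) > 0"
  using prob_tint_ge[OF proj_measurable \<alpha>, of u] \<alpha> by (simp add: trim_def)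

text \<open>After expanding the square, the mixed terms vanish by
  \<open>cexp_trim_orthogonal\<close>.\<close>

lemma trimmed_variance_combine:
  assumes "gram u w = 0"
  shows "trimmed_variance \<alpha> u (a *\<^sub>R u + b *\<^sub>R w)
    = a\<^sup>2 * trimmed_variance \<alpha> u u + b\<^sup>2 * trimmed_variance \<alpha> u w"
proof -
  let ?A = "trim \<alpha> u"
  define m where "m = cexp M ?A (proj u)"
  note lin = cexp_linear[OF trim_sets, of _ _ \<alpha> u]
  note zero = cexp_trim_orthogonal[OF assms, of \<alpha>]
  have mean: "cexp M ?A (proj (a *\<^sub>R u + b *\<^sub>R w)) = a * m"
    by (simp add: proj_linear[abs_def] lin cexp_cmult proj_integrable zero m_def)
  have sq: "(a * proj u \<omega> + b * proj w \<omega> - a * m)\<^sup>2 = a\<^sup>2 * (proj u \<omega> - m)\<^sup>2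
      + (b\<^sup>2 * (proj w \<omega>)\<^sup>2 + (2 * a * b * (proj u \<omega> * proj w \<omega>) - 2 * a * b * m * proj w \<omega>))" for \<omega>
    by (simp add: power2_eq_square algebra_simps)
  have int: "integrable M (\<lambda>\<omega>. (proj u \<omega> - c)\<^sup>2)" "integrable M (\<lambda>\<omega>. (proj u \<omega>)\<^sup>2)" for u c
    using proj_integrable[of u] proj_integrable(2)[of u u] by (auto simp: power2_eq_square algebra_simps)
  show ?thesis
    unfolding trimmed_variance_def mean m_def[symmetric] unfolding proj_linear sq
    by (simp add: lin cexp_cmult int proj_integrable zero)
qed

lemma trimmed_variance_le:
  assumes "gram u u = 1" "gram w w = 1" "gram u w = 0"
  shows "trimmed_variance \<alpha> u u \<le> trimmed_variance \<alpha> u w"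
proof -
  let ?A = "trim \<alpha> u"
  define m h where "m = cexp M ?A (proj u)" and "h = quantile M (proj u) (1 - \<alpha> / 2)"
  note lin = cexp_linear[OF trim_sets, of _ _ \<alpha> u]
  have int: "integrable M (\<lambda>\<omega>. (proj u \<omega>)\<^sup>2)" for u
    using proj_integrable(2)[of u u] by (simp add: power2_eq_square)
  have "(proj u \<omega> - m)\<^sup>2 = (proj u \<omega>)\<^sup>2 - (2 * m * proj u \<omega> - m\<^sup>2)" for \<omega>
    by (simp add: power2_eq_square algebra_simps)
  then have "trimmed_variance \<alpha> u u = cexp M ?A (\<lambda>\<omega>. (proj u \<omega>)\<^sup>2) - (2 * m * m - m\<^sup>2)"
    unfolding trimmed_variance_def m_def[symmetric]
    by (simp add: lin cexp_cmult int proj_integrable cexp_const prob_trim_pos m_def[symmetric])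
  \<comment> \<open>Dropping the square of the conditional mean leaves the second moment as an upper
    bound.\<close>
  then have "trimmed_variance \<alpha> u u \<le> cexp M ?A (\<lambda>\<omega>. (proj u \<omega>)\<^sup>2)"
    by (simp add: power2_eq_square)
  also have "\<dots> \<le> cexp M ?A (\<lambda>\<omega>. (proj w \<omega>)\<^sup>2)"
  proof -
    have "AE \<omega> in M. proj u \<omega> \<in> tint M (proj u) \<alpha> \<longleftrightarrow> \<bar>proj u \<omega>\<bar> \<le> h"
      unfolding h_def
    proof (rule AE_tint_symmetric[OF proj_measurable \<alpha>])
      fix x
      show "prob {\<omega> \<in> space M. proj u \<omega> \<le> x} = prob {\<omega> \<in> space M. - proj u \<omega> \<le> x}"
        using prob_cong[of u "- u" "{..x}"] by (simp add: gram_bilinear proj_linear)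
    qed (use proj_no_atom assms in blast)
    then have AE: "AE \<omega> in M. indicator ?A \<omega> = indicat_real {-h..h} (proj u \<omega>)"
      using AE_space by eventually_elim (auto simp: trim_def indicator_def)
    \<comment> \<open>The trimmed event has been replaced, up to a null set, by a symmetric one with
      threshold \<open>h\<close>. Exchanging \<open>u\<close> and \<open>w\<close> preserves the
      joint law and carries the event to its mirror image with the same threshold.\<close>
    let ?F = "\<lambda>p. indicator {-h..h} (fst p) * ((snd p)\<^sup>2 - (fst p)\<^sup>2) :: real"
    let ?I = "\<integral>\<omega>. ?F (proj u \<omega>, proj w \<omega>) \<partial>M"
    have swap: "?I = (\<integral>\<omega>. ?F (proj w \<omega>, proj u \<omega>) \<partial>M)"
      using assms by (intro expectation_cong) (auto simp: gram_commute[of w u])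
    have F_int: "integrable M (\<lambda>\<omega>. ?F (proj v \<omega>, proj v' \<omega>))" for v v'
    proof -
      have "integrable M (\<lambda>\<omega>. indicator {\<omega> \<in> space M. proj v \<omega> \<in> {-h..h}} \<omega> * ((proj v' \<omega>)\<^sup>2 - (proj v \<omega>)\<^sup>2))"
        by (intro integrable_indicator_mult Bochner_Integration.integrable_diff int) measurable
      also have "?this \<longleftrightarrow> ?thesis"
        by (intro Bochner_Integration.integrable_cong refl) (auto simp: indicator_def)
      finally show ?thesis .
    qed
    have "2 * ?I = (\<integral>\<omega>. ?F (proj u \<omega>, proj w \<omega>) + ?F (proj w \<omega>, proj u \<omega>) \<partial>M)"
      using swap Bochner_Integration.integral_add[OF F_int[of u w] F_int[of w u]] by simp
    \<comment> \<open>If both projections lie within \<open>h\<close>, the two summands cancel; if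
      exactly one does, it has the smaller square; otherwise both summands are zero.\<close>
    also have "\<dots> \<ge> 0"
    proof (rule integral_nonneg_AE, rule AE_I2)
      fix \<omega>
      have "(proj u \<omega>)\<^sup>2 \<le> (proj w \<omega>)\<^sup>2" if "\<bar>proj u \<omega>\<bar> \<le> h" "\<not> \<bar>proj w \<omega>\<bar> \<le> h"
        using that by (intro abs_le_square_iff[THEN iffD1]) linarith
      moreover have "(proj w \<omega>)\<^sup>2 \<le> (proj u \<omega>)\<^sup>2" if "\<bar>proj w \<omega>\<bar> \<le> h" "\<not> \<bar>proj u \<omega>\<bar> \<le> h"
        using that by (intro abs_le_square_iff[THEN iffD1]) linarith
      ultimately show "0 \<le> ?F (proj u \<omega>, proj w \<omega>) + ?F (proj w \<omega>, proj u \<omega>)"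
        by (auto simp: indicator_def abs_le_iff)
    qed
    finally have "0 \<le> ?I" by simp
    also have "?I = (\<integral>\<omega>. indicator ?A \<omega> * (proj w \<omega>)\<^sup>2 - indicator ?A \<omega> * (proj u \<omega>)\<^sup>2 \<partial>M)"
    proof (rule integral_cong_AE)
      show "AE \<omega> in M. ?F (proj u \<omega>, proj w \<omega>)
        = indicator ?A \<omega> * (proj w \<omega>)\<^sup>2 - indicator ?A \<omega> * (proj u \<omega>)\<^sup>2"
        using AE by eventually_elim (simp add: right_diff_distrib)
    qed measurable
    also have "\<dots> = (\<integral>\<omega>. indicator ?A \<omega> * (proj w \<omega>)\<^sup>2 \<partial>M) - (\<integral>\<omega>. indicator ?A \<omega> * (proj u \<omega>)\<^sup>2 \<partial>M)"
      by (intro Bochner_Integration.integral_diff integrable_indicator_mult int trim_sets)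
    finally show ?thesis
      unfolding cexp_def by (intro divide_right_mono) auto
  qed
  also have "\<dots> = trimmed_variance \<alpha> u w"
    by (simp add: trimmed_variance_def cexp_trim_orthogonal assms)
  finally show ?thesis .
qed

text \<open>By \<open>trimmed_variance_cong\<close> the trimmed variance takes one value on all unit
  vectors and one on all orthonormal pairs. A general \<open>v\<close> is split into its component
  along \<open>u\<close> and a Gram-orthogonal rest.\<close>

lemma trimmed_variance_decomposition:
  obtains k c where "k \<le> c"
    "\<And>u v. gram u u = 1 \<Longrightarrow>
      trimmed_variance \<alpha> u v = k * (gram v u)\<^sup>2 + c * (gram v v - (gram v u)\<^sup>2)"
proof -
  define orthonormal where "orthonormal u w \<longleftrightarrow> gram u u = 1 \<and> gram w w = 1 \<and> gram u w = 0" for u w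
  \<comment> \<open>An arbitrarily chosen unit vector serves as reference; whenever the property is
    applied, the given \<open>u\<close> witnesses that one exists.\<close>
  obtain k where k: "\<And>u. gram u u = 1 \<Longrightarrow> trimmed_variance \<alpha> u u = k"
  proof (rule that)
    fix u assume "gram u u = 1"
    moreover from this have "gram (SOME u. gram u u = 1) (SOME u. gram u u = 1) = 1" by (rule someI[where P = "\<lambda>u. gram u u = 1"])
    ultimately show "trimmed_variance \<alpha> u u
      = trimmed_variance \<alpha> (SOME u. gram u u = 1) (SOME u. gram u u = 1)"
      by (intro trimmed_variance_cong) simp_all
  qed
  \<comment> \<open>In dimension one there is no orthonormal pair, and the value of \<open>c\<close> is irrelevant.\<close>
  obtain c where c: "k \<le> c" "\<And>u w. orthonormal u w \<Longrightarrow> trimmed_variance \<alpha> u w = c"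
  proof (cases "\<exists>u w. orthonormal u w")
    case True
    then obtain u w where uw: "orthonormal u w" by blast
    show ?thesis
    proof (rule that)
      show "k \<le> trimmed_variance \<alpha> u w"
        using trimmed_variance_le[of u w] uw k[of u] by (simp add: orthonormal_def)
      show "trimmed_variance \<alpha> u' w' = trimmed_variance \<alpha> u w" if "orthonormal u' w'" for u' w'
        using that uw by (intro trimmed_variance_cong) (auto simp: orthonormal_def)
    qed
  next
    case False
    then show ?thesis using that[of k] by blast
  qed
  show ?thesis
  proof (rule that[OF c(1)])
    fix u v assume u: "gram u u = 1"
    define a w where "a = gram v u" and "w = v - a *\<^sub>R u"
    have v: "v = a *\<^sub>R u + 1 *\<^sub>R w" by (simp add: w_def)
    have uw: "gram u w = 0" using u by (simp add: w_def a_def gram_bilinear gram_commute[of u v])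
    have ww: "gram w w = gram v v - a\<^sup>2"
      using u by (simp add: w_def a_def gram_bilinear gram_commute[of u v] power2_eq_square)
    have "trimmed_variance \<alpha> u w = gram w w * c"
    proof (cases "w = 0")
      case True
      then show ?thesis by (simp add: gram_bilinear trimmed_variance_def proj_linear[abs_def] cexp_def)
    next
      case False
      define r where "r = sqrt (gram w w)"
      have r: "r > 0" "r\<^sup>2 = gram w w" using pos_def[OF False] by (auto simp: r_def gram_def)
      have "gram (w /\<^sub>R r) (w /\<^sub>R r) = 1"
        using r by (simp add: gram_bilinear r(2)[symmetric] power2_eq_square field_simps)
      then have "orthonormal u (w /\<^sub>R r)"
        using u uw by (simp add: orthonormal_def gram_bilinear)
      \<comment> \<open>The zero multiple of \<open>u\<close> lets
        \<open>trimmed_variance_combine\<close> act as a scaling rule.\<close>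
      then have "trimmed_variance \<alpha> u (0 *\<^sub>R u + r *\<^sub>R (w /\<^sub>R r)) = r\<^sup>2 * c"
        using c(2) uw by (subst trimmed_variance_combine) (auto simp: gram_bilinear)
      then show ?thesis using r by simp
    qed
    then show "trimmed_variance \<alpha> u v = k * (gram v u)\<^sup>2 + c * (gram v v - (gram v u)\<^sup>2)"
      using trimmed_variance_combine[OF uw, of a 1, folded v] k[OF u]
      by (simp add: ww a_def[symmetric])
  qed
qed

text \<open>Summing the decomposition over the rows of \<open>P\<close> gives two invariants of
  orthogonal matrices: a trace and the length of \<open>S *v u\<close>. The choice of
  \<open>P\<close> survives only through its conditioning row.\<close>

lemma trace_ccov_tevent:
  obtains k c where "k \<le> c"
    "\<And>P j. orthogonal_matrix P \<Longrightarrow>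
      trace (ccov M (tevent M (\<lambda>\<omega>. P *v X \<omega>) j \<alpha>) (\<lambda>\<omega>. P *v X \<omega>))
      = c * trace S - (c - k) * ((norm (S *v (P $ j)))\<^sup>2 / gram (P $ j) (P $ j))"
proof -
  obtain k c where kc: "k \<le> c" "\<And>u v. gram u u = 1 \<Longrightarrow>
      trimmed_variance \<alpha> u v = k * (gram v u)\<^sup>2 + c * (gram v v - (gram v u)\<^sup>2)"
    using trimmed_variance_decomposition by blast
  show ?thesis
  proof (rule that[OF kc(1)])
    fix P :: "real^'d^'d" and j assume P: "orthogonal_matrix P"
    define p b where "p = P $ j" and "b = sqrt (gram p p)"
    define u where "u = p /\<^sub>R b"
    have "norm p = 1"
      using P by (simp add: orthogonal_matrix_orthonormal_rows p_def row_def vec_lambda_eta)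
    then have p0: "p \<noteq> 0" by auto
    have b: "b > 0" "b\<^sup>2 = gram p p" using pos_def[OF p0] by (auto simp: b_def gram_def)
    have u: "gram u u = 1" using b by (simp add: u_def gram_bilinear b(2)[symmetric] power2_eq_square field_simps)
    have event: "tevent M (\<lambda>\<omega>. P *v X \<omega>) j \<alpha> = trim \<alpha> u"
      using tevent_eq_trim[OF \<alpha>, of P j] p0 by (simp add: u_def p_def b_def)
    have entry: "cexp M (trim \<alpha> u) (\<lambda>\<omega>. ((P *v X \<omega>) $ i - cexp M (trim \<alpha> u) (\<lambda>\<omega>. (P *v X \<omega>) $ i))
        * ((P *v X \<omega>) $ i - cexp M (trim \<alpha> u) (\<lambda>\<omega>. (P *v X \<omega>) $ i))) = trimmed_variance \<alpha> u (P $ i)" for i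
    proof -
      have *: "(P *v X \<omega>) $ i = proj (P $ i) \<omega> + P $ i \<bullet> \<mu>" for \<omega>
        by (simp add: proj_def matrix_vector_mul_component inner_simps)
      have "cexp M (trim \<alpha> u) (\<lambda>\<omega>. (P *v X \<omega>) $ i) = cexp M (trim \<alpha> u) (proj (P $ i)) + P $ i \<bullet> \<mu>"
        unfolding * by (simp add: cexp_linear proj_integrable cexp_const prob_trim_pos)
      then show ?thesis
        unfolding trimmed_variance_def by (simp add: * power2_eq_square)
    qed
    have "trace (ccov M (tevent M (\<lambda>\<omega>. P *v X \<omega>) j \<alpha>) (\<lambda>\<omega>. P *v X \<omega>))
      = (\<Sum>i\<in>UNIV. trimmed_variance \<alpha> u (P $ i))"
      unfolding event by (simp add: trace_def ccov_def entry)
    also have "\<dots> = c * (\<Sum>i\<in>UNIV. gram (P $ i) (P $ i)) - (c - k) * (\<Sum>i\<in>UNIV. (gram (P $ i) u)\<^sup>2)"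
      by (simp add: kc(2)[OF u] algebra_simps sum.distrib sum_subtractf sum_distrib_left)
    also have "(\<Sum>i\<in>UNIV. gram (P $ i) (P $ i)) = trace S"
    proof -
      have "gram (P $ i) (P $ i) = (P ** S ** transpose P) $ i $ i" for i
        by (simp add: gram_def matrix_matrix_mult_def matrix_vector_mult_def inner_vec_def transpose_def
            sum_distrib_left sum_distrib_right ac_simps)
          (subst sum.swap, simp add: ac_simps)
      then have "(\<Sum>i\<in>UNIV. gram (P $ i) (P $ i)) = trace (P ** S ** transpose P)"
        by (simp add: trace_def)
      also have "\<dots> = trace (transpose P ** P ** S)"
        by (metis matrix_mul_assoc trace_mul_sym)
      finally show ?thesis using P by (simp add: orthogonal_matrix_def)
    qed
    \<comment> \<open>The Gram entries are the coordinates of \<open>P *v (S *v u)\<close>, and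
      \<open>P\<close> preserves length.\<close>
    also have "(\<Sum>i\<in>UNIV. (gram (P $ i) u)\<^sup>2) = (norm (S *v p))\<^sup>2 / gram p p"
    proof -
      have "(\<Sum>i\<in>UNIV. (gram (P $ i) u)\<^sup>2) = (norm (P *v (S *v u)))\<^sup>2"
        unfolding power2_norm_eq_inner inner_vec_def[of "P *v (S *v u)"]
        by (simp add: gram_def matrix_vector_mul_component power2_eq_square)
      also have "norm (P *v (S *v u)) = norm (S *v u)"
        using P by (intro orthogonal_transformation_norm)
          (simp add: orthogonal_transformation_matrix matrix_vector_mul_linear)
      also have "S *v u = (S *v p) /\<^sub>R b" by (simp add: u_def matrix_vector_mult_scaleR)
      finally show ?thesis
        by (simp add: power_mult_distrib divide_inverse power_inverse b(2))
    qed
    finally show "trace (ccov M (tevent M (\<lambda>\<omega>. P *v X \<omega>) j \<alpha>) (\<lambda>\<omega>. P *v X \<omega>))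
      = c * trace S - (c - k) * ((norm (S *v (P $ j)))\<^sup>2 / gram (P $ j) (P $ j))"
      by (simp add: p_def)
  qed
qed

end

end

section \<open>Spectral bounds and the extremal directions\<close>

lemma row_eq_nth: "row i A = A $ i"
  by (simp add: row_def vec_lambda_eta)

lemma orthogonal_matrix_permute_rows:
  fixes A :: "real^'n^'n"
  assumes A: "orthogonal_matrix A" and "inj \<sigma>"
  shows "orthogonal_matrix (\<chi> r. A $ \<sigma> r)"
  using A injD[OF \<open>inj \<sigma>\<close>] unfolding orthogonal_matrix_orthonormal_rows row_eq_nth
  by (simp, blast)

context
  fixes S V :: "real^'n^'n" and lam :: "'n \<Rightarrow> real"
  assumes V: "orthogonal_matrix V"
    and S: "S = V ** (\<chi> j k. if j = k then lam j else 0) ** transpose V"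
begin

lemma spectral_mult_vec:
  "S *v p = V *v (\<chi> j. lam j * (transpose V *v p) $ j)"
proof -
  have "(\<chi> j k. if j = k then lam j else 0) *v x = (\<chi> j. lam j * x $ j)" for x :: "real^'n"
    by (simp add: vec_eq_iff matrix_vector_mult_def if_distrib[of "\<lambda>z. z * _"] cong: if_cong)
  then show ?thesis unfolding S by (simp only: matrix_vector_mul_assoc[symmetric])
qed

lemma spectral_symmetric: "transpose S = S"
proof -
  have "transpose (\<chi> j k. if j = k then lam j else 0) = (\<chi> j k. if j = k then lam j else (0::real))"
    by (simp add: transpose_def vec_eq_iff)
  then show ?thesis unfolding S by (simp add: matrix_transpose_mul matrix_mul_assoc)
qed

lemma spectral_quadratic_form: "p \<bullet> (S *v p) = (\<Sum>j\<in>UNIV. lam j * ((transpose V *v p) $ j)\<^sup>2)"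
proof -
  have "p \<bullet> (V *v y) = (transpose V *v p) \<bullet> y" for y
    by (metis dot_lmul_matrix transpose_matrix_vector)
  then show ?thesis
    unfolding spectral_mult_vec inner_vec_def[of "transpose V *v p"]
    by (simp add: power2_eq_square ac_simps)
qed

lemma spectral_norm_sq: "(norm (S *v p))\<^sup>2 = (\<Sum>j\<in>UNIV. (lam j)\<^sup>2 * ((transpose V *v p) $ j)\<^sup>2)"
proof -
  have "norm (V *v y) = norm y" for y
    using V by (intro orthogonal_transformation_norm)
      (simp add: orthogonal_transformation_matrix matrix_vector_mul_linear)
  then show ?thesis
    unfolding spectral_mult_vec
    by (simp only: power2_norm_eq_inner) (simp add: inner_vec_def power2_eq_square ac_simps)
qed

text \<open>In eigenvector coordinates \<open>y\<close>, the quotient is the mean of the eigenvalues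
  with the nonnegative weights \<open>lam j * (y $ j)\<^sup>2\<close>.\<close>

lemma spectral_ratio_bounds:
  assumes pos: "p \<bullet> (S *v p) > 0" and lam: "\<And>j. 0 < lam j" "\<And>j. l \<le> lam j" "\<And>j. lam j \<le> L"
  shows "l \<le> (norm (S *v p))\<^sup>2 / (p \<bullet> (S *v p))" "(norm (S *v p))\<^sup>2 / (p \<bullet> (S *v p)) \<le> L"
proof -
  have "l * (p \<bullet> (S *v p)) \<le> (norm (S *v p))\<^sup>2"
    unfolding spectral_quadratic_form spectral_norm_sq sum_distrib_left
    by (intro sum_mono) (simp only: mult.assoc[symmetric] power2_eq_square[of "lam _"],
        intro mult_right_mono zero_le_power2 lam less_imp_le[OF lam(1)])
  moreover have "(norm (S *v p))\<^sup>2 \<le> L * (p \<bullet> (S *v p))"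
    unfolding spectral_quadratic_form spectral_norm_sq sum_distrib_left
    by (intro sum_mono) (simp only: mult.assoc[symmetric] power2_eq_square[of "lam _"],
        intro mult_right_mono zero_le_power2 lam less_imp_le[OF lam(1)])
  ultimately show "l \<le> (norm (S *v p))\<^sup>2 / (p \<bullet> (S *v p))" "(norm (S *v p))\<^sup>2 / (p \<bullet> (S *v p)) \<le> L"
    using pos by (auto simp: field_simps)
qed

text \<open>A row of \<open>transpose V\<close> is a column of \<open>V\<close>, so it has a single
  nonzero coordinate in the eigenbasis.\<close>

lemma spectral_ratio_eigenvector:
  assumes "0 < lam j"
  defines "p \<equiv> transpose V $ j"
  shows "(norm (S *v p))\<^sup>2 / (p \<bullet> (S *v p)) = lam j"
proof -
  have "(transpose V *v p) $ k = (if k = j then 1 else 0)" for k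
  proof -
    have "(transpose V *v p) $ k = (transpose V ** V) $ k $ j"
      by (simp add: p_def matrix_vector_mult_def matrix_matrix_mult_def transpose_def)
    then show ?thesis using V by (simp add: orthogonal_matrix_def mat_def)
  qed
  then show ?thesis
    using assms(1) unfolding spectral_quadratic_form spectral_norm_sq
    by (simp add: if_distrib[of "\<lambda>z. _ * z"] power2_eq_square cong: if_cong)
qed

end

theorem theorem8:
  fixes i :: "'d::{finite,linorder}" and M :: "'a measure" and X :: "'a \<Rightarrow> (real, 'd) vec"
    and \<mu> :: "(real, 'd) vec" and \<Sigma> V :: "((real, 'd) vec, 'd) vec" and \<phi> :: "real \<Rightarrow> complex"
    and lam :: "'d \<Rightarrow> real" and \<alpha> :: real
  assumes "prob_space M"
    and "X \<in> borel_measurable M"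
    and "\<And>j. integrable M (\<lambda>\<omega>. (X \<omega> $ j)^2)"
    and "elliptical M X \<mu> \<Sigma> \<phi>"
    and "\<Sigma> = cov M X"
    and "\<And>v. v \<noteq> 0 \<Longrightarrow> v \<bullet> (\<Sigma> *v v) > 0"
    and "orthogonal_matrix V"
    and "\<Sigma> = V ** (\<chi> j k. if j = k then lam j else 0) ** transpose V"
    and "\<And>j k. j \<le> k \<Longrightarrow> lam k \<le> lam j"
    and "\<And>j. lam j > 0"
    and "0 < \<alpha>" and "\<alpha> < 1"
  shows
    "(let f = (\<lambda>P. trace (ccov M (tevent M (\<lambda>\<omega>. P *v X \<omega>) i \<alpha>) (\<lambda>\<omega>. P *v X \<omega>)));
          Y = (\<lambda>\<omega>. transpose V *v X \<omega>);
          \<P> = {P. orthogonal_matrix P}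
      in (trace (ccov M (tevent M Y (Max UNIV) \<alpha>) Y) \<in> f ` \<P> \<and>
          (\<forall>P\<in>\<P>. f P \<le> trace (ccov M (tevent M Y (Max UNIV) \<alpha>) Y))) \<and>
         (trace (ccov M (tevent M Y (Min UNIV) \<alpha>) Y) \<in> f ` \<P> \<and>
          (\<forall>P\<in>\<P>. trace (ccov M (tevent M Y (Min UNIV) \<alpha>) Y) \<le> f P)))"
proof -
  note spectral = assms(7,8)
  interpret elliptical_vector M X \<mu> \<Sigma> \<phi>
    using assms(1-4,6) spectral_symmetric[OF spectral]
    by (auto simp: elliptical_vector_def elliptical_vector_axioms_def)
  define ratio where "ratio p = (norm (\<Sigma> *v p))\<^sup>2 / (p \<bullet> (\<Sigma> *v p))" for p
  define f :: "((real, 'd) vec, 'd) vec \<Rightarrow> 'd \<Rightarrow> real" where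
    "f P j = trace (ccov M (tevent M (\<lambda>\<omega>. P *v X \<omega>) j \<alpha>) (\<lambda>\<omega>. P *v X \<omega>))" for P j
  obtain k c where kc: "k \<le> c"
    and f: "\<And>P j. orthogonal_matrix P \<Longrightarrow> f P j = c * trace \<Sigma> - (c - k) * ratio (P $ j)"
    using trace_ccov_tevent[OF assms(11,12)] unfolding f_def ratio_def gram_def by blast
  have V: "orthogonal_matrix (transpose V)" using assms(7) by simp
  have ratio_V: "ratio (transpose V $ j) = lam j" for j
    unfolding ratio_def by (rule spectral_ratio_eigenvector[OF spectral assms(10)])
  \<comment> \<open>The eigenvalues decrease along the index order, so \<open>Max UNIV\<close>
    carries the smallest and \<open>Min UNIV\<close> the largest.\<close>
  have ratio_ge: "lam (Max UNIV) \<le> ratio (P $ j)" and ratio_le: "ratio (P $ j) \<le> lam (Min UNIV)"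
    if "orthogonal_matrix P" for P j
  proof -
    have "norm (P $ j) = 1"
      using that unfolding orthogonal_matrix_orthonormal_rows row_eq_nth by simp
    then have "P $ j \<noteq> 0" by auto
    then show "lam (Max UNIV) \<le> ratio (P $ j)" "ratio (P $ j) \<le> lam (Min UNIV)"
      unfolding ratio_def
      using spectral_ratio_bounds[OF spectral, of "P $ j" "lam (Max UNIV)" "lam (Min UNIV)"]
      by (simp_all add: assms(6,9,10))
  qed
  have attained: "f (transpose V) m \<in> (\<lambda>P. f P i) ` {P. orthogonal_matrix P}" for m
  proof -
    \<comment> \<open>Swapping rows \<open>i\<close> and \<open>m\<close> moves the wanted
      eigenvector into the conditioning row, the only row on which the value depends.\<close>
    define P where "P = (\<chi> r. transpose V $ Transposition.transpose i m r)"
    have "orthogonal_matrix P"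
      unfolding P_def by (intro orthogonal_matrix_permute_rows V inj_transpose)
    moreover have "P $ i = transpose V $ m" by (simp add: P_def)
    then have "f P i = f (transpose V) m"
      by (simp add: f[OF V] f[OF \<open>orthogonal_matrix P\<close>])
    ultimately show ?thesis by (metis (mono_tags, lifting) image_eqI mem_Collect_eq)
  qed
  \<comment> \<open>Because \<open>c - k\<close> is nonnegative, \<open>f\<close> decreases in the
    ratio, so the smallest eigenvalue gives the maximum and the largest the minimum.\<close>
  have "f P i \<le> f (transpose V) (Max UNIV)" "f (transpose V) (Min UNIV) \<le> f P i"
    if "orthogonal_matrix P" for P
    using kc ratio_ge[OF that, of i] ratio_le[OF that, of i]
    by (auto simp: f[OF that] f[OF V] ratio_V intro!: mult_left_mono)
  with attained show ?thesis
    unfolding Let_def f_def by auto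
qed

end
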